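(* Let $(V_i,v_i,\varphi^{(i)})_{i\in I}$ be a fusion frame system for $\mathcal{H}$, $V=(V_i,v_i)_{i\in I}$, and let $v\varphi=(v_i\varphi_{ij})_{i\in I,j\in J_i}$ be the corresponding global frame. (1) If $\varphi^{(i)}$ is Parseval for every $i\in I$, then $V$ is Parseval if and only if $v\varphi$ is Parseval. (2) If $\varphi^{(i)}$ is Parseval for every $i\in I$, then $V$ is $A$-tight if and only if $v\varphi$ is $A$-tight. (3) If $\varphi^{(i)}$ is $A$-tight for every $i\in I$ (with the same $A$), then $V$ is tight if and only if $v\varphi$ is tight. (4) In case $\mathcal{H}$ is a reproducing kernel Hilbert space: if $\varphi^{(i)}$ is Parseval for every $i\in I$, then $V$ is painless if and only if $v\varphi$ is painless. (5) In case $\mathcal{H}$ is a reproducing kernel Hilbert space: if $\varphi^{(i)}$ is $A$-tight for every $i\in I$ (with the same $A$), then $V$ is painless if and only if $v\varphi$ is painless.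
   Context: $\mathcal{H}$ is a separable Hilbert space; $\pi_U$ denotes the orthogonal projection onto a closed subspace $U$. A frame for a Hilbert space $K$ is a countable family $\psi=(\psi_j)_{j\in J}$ in $K$ with constants $0<A_\psi\le B_\psi<\infty$ (frame bounds) such that $A_\psi\|f\|^2\le\sum_j|\langle f,\psi_j\rangle|^2\le B_\psi\|f\|^2$ for all $f\in K$. For a constant $A>0$, it is $A$-tight if one can take $A_\psi=B_\psi=A$; it is tight if it is $A$-tight for some $A$, and Parseval if it is $1$-tight. Its frame operator is $S_\psi f=\sum_j\langle f,\psi_j\rangle\psi_j$. A fusion frame for $\mathcal{H}$ is a countable family $V=(V_i,v_i)_{i\in I}$ of closed subspaces with weights $v_i>0$ for which there are constants $0<A_V\le B_V<\infty$ (fusion frame bounds) with $A_V\|f\|^2\le\sum_{i} v_i^2\|\pi_{V_i}f\|^2\le B_V\|f\|^2$ for all $f\in\mathcal{H}$. For a constant $A>0$, it is $A$-tight if one can take $A_V=B_V=A$; it is tight if it is $A$-tight for some $A$, and Parseval if it is $1$-tight. Its fusion frame operator is $S_Vf=\sum_iv_i^2\pi_{V_i}f$. A fusion frame system $(V_i,v_i,\varphi^{(i)})_{i\in I}$ for $\mathcal{H}$ consists of a fusion frame $V=(V_i,v_i)_{i\in I}$ for $\mathcal{H}$ and, for every $i\in I$, a frame $\varphi^{(i)}=(\varphi_{ij})_{j\in J_i}$ for $V_i$, such that these local frames have common frame bounds (that is, one pair of positive finite constants serves as frame bounds for all of them). Its global frame is $v\varphi=(v_i\varphi_{ij})_{i\in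 I,j\in J_i}$, which is a frame for $\mathcal{H}$. Within each part of the claim, $A$ denotes one and the same positive constant. A reproducing kernel Hilbert space is a Hilbert space of functions $f:X\to\mathbb{F}$ ($\mathbb{F}=\mathbb{R}$ or $\mathbb{C}$) for which all point evaluations $f\mapsto f(x)$ ($x\in X$) are continuous. In this case a frame $\psi$ (resp. fusion frame $V$) for $\mathcal{H}$ is called painless if its frame operator is a multiplication operator, i.e. there is a function $m:X\to\mathbb{F}$ with $S_\psi f(x)=m(x)f(x)$ (resp. $S_Vf(x)=m(x)f(x)$) for all $f\in\mathcal{H}$, $x\in X$. *)

theory Defs
  imports "HOL-Analysis.Analysis" "HOL-Library.Function_Algebras"
begin

(* The scalar field F is a type of the following class.  As real_or_complex_cases shows, the
   axioms leave only the real numbers (with cj the identity) and the complex numbers (with cj the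
   complex conjugation), up to isomorphism. *)
class real_or_complex = real_normed_field +
  fixes cj :: "'a \<Rightarrow> 'a"
  assumes cj_add: "cj (x + y) = cj x + cj y"
    and cj_mult: "cj (x * y) = cj x * cj y"
    and cj_scaleR_one: "cj (r *\<^sub>R 1) = r *\<^sub>R 1"
    and mult_cj_scaleR: "x * cj x = (norm x)\<^sup>2 *\<^sub>R 1"

lemma cj_of_real: "cj (of_real r :: 'a::real_or_complex) = of_real r"
  by (simp add: of_real_def cj_scaleR_one)

lemma mult_cj: "x * cj x = (of_real ((norm x)\<^sup>2) :: 'a::real_or_complex)"
  unfolding of_real_def by (rule mult_cj_scaleR)

instantiation real :: real_or_complex
begin

definition cj_real :: "real \<Rightarrow> real" where
  "cj_real x = x"

instance
  by standard (simp_all add: cj_real_def power2_eq_square)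

end

instantiation complex :: real_or_complex
begin

definition cj_complex :: "complex \<Rightarrow> complex" where
  "cj_complex z = cnj z"

instance
  by standard
    (simp_all add: cj_complex_def scaleR_conv_of_real complex_norm_square[symmetric]
      del: of_real_power)

end

lemma real_or_complex_decompose:
  fixes z :: "'a::real_or_complex"
  obtains a w where "z = of_real a + w" "w * w = - of_real ((norm w)\<^sup>2)"
proof -
  have cj1: "cj (1::'a) = 1"
    using cj_of_real[of 1, where ?'a = 'a] by simp
  have "(1 + z) * cj (1 + z) = of_real ((norm (1 + z))\<^sup>2)"
    by (rule mult_cj)
  then have "1 + z + cj z + z * cj z = of_real ((norm (1 + z))\<^sup>2)"
    by (simp add: cj_add cj1 algebra_simps)
  then have s: "z + cj z = of_real ((norm (1 + z))\<^sup>2 - 1 - (norm z)\<^sup>2)"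
    unfolding mult_cj by (simp add: algebra_simps)
  define a where "a = ((norm (1 + z))\<^sup>2 - 1 - (norm z)\<^sup>2) / 2"
  have s': "z + cj z = of_real a + of_real a"
    unfolding s a_def of_real_add[symmetric] by (simp del: of_real_diff of_real_power)
  define w where "w = z - of_real a"
  have "cj z = cj w + of_real a"
    using cj_add[of w "of_real a"] by (simp add: w_def cj_of_real)
  moreover have "z = w + of_real a"
    by (simp add: w_def)
  ultimately have "w + cj w = 0"
    using s' by (simp add: algebra_simps)
  then have "cj w = - w"
    by (simp add: eq_neg_iff_add_eq_0 add.commute)
  then have "w * w = - of_real ((norm w)\<^sup>2)"
    using mult_cj[of w] by (metis minus_equation_iff mult_minus_right)
  then show ?thesis
    using that[of a w] by (simp add: w_def)
qed

lemma real_or_complex_cases: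
  "(\<forall>z::'a::real_or_complex. \<exists>a. z = of_real a) \<or>
   (\<exists>\<i>'::'a. \<i>' * \<i>' = - 1 \<and> (\<forall>z. \<exists>a b. z = of_real a + of_real b * \<i>'))"
proof (cases "\<forall>z::'a. \<exists>a. z = of_real a")
  case False
  then obtain z :: 'a where z: "\<nexists>a. z = of_real a" by blast
  obtain a w where w: "z = of_real a + w" "w * w = - of_real ((norm w)\<^sup>2)"
    by (rule real_or_complex_decompose)
  have w0: "w \<noteq> 0" using z w(1) by auto
  define j where "j = w / of_real (norm w)"
  have jj: "j * j = - 1"
    using w0 by (simp add: j_def w(2) power2_eq_square)
  have "\<exists>a b. z' = of_real a + of_real b * j" for z' :: 'a
  proof -
    obtain a' w' where w': "z' = of_real a' + w'" "w' * w' = - of_real ((norm w')\<^sup>2)"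
      by (rule real_or_complex_decompose)
    have "(of_real (norm w') * j) * (of_real (norm w') * j) = w' * w'"
      using jj w'(2) by (simp add: power2_eq_square mult.assoc mult.left_commute[of j])
    then have "w' = of_real (norm w') * j \<or> w' = - (of_real (norm w') * j)"
      by (metis square_eq_iff)
    then have "w' = of_real (norm w') * j \<or> w' = of_real (- norm w') * j"
      by simp
    then show ?thesis
    proof
      assume "w' = of_real (norm w') * j"
      then show ?thesis using w'(1) by (intro exI[of _ a'] exI[of _ "norm w'"]) simp
    next
      assume "w' = of_real (- norm w') * j"
      then show ?thesis using w'(1) by (intro exI[of _ a'] exI[of _ "- norm w'"]) simp
    qed
  qed
  with jj show ?thesis by blast
qed simp


definition ip_norm :: "('v \<Rightarrow> 'v \<Rightarrow> 'f::real_or_complex) \<Rightarrow> 'v \<Rightarrow> real" where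
  "ip_norm ip f = sqrt (norm (ip f f))"

(* The guard makes ip_dist a metric in the sense of Metric_space, whose axiom of symmetry ranges
   over the whole type, although ip is meaningful on H only. *)
definition ip_dist ::
    "'v set \<Rightarrow> ('v::ab_group_add \<Rightarrow> 'v \<Rightarrow> 'f::real_or_complex) \<Rightarrow> 'v \<Rightarrow> 'v \<Rightarrow> real" where
  "ip_dist H ip f g = (if f \<in> H \<and> g \<in> H then ip_norm ip (f - g) else 0)"

abbreviation ip_topology ::
    "'v set \<Rightarrow> ('v::ab_group_add \<Rightarrow> 'v \<Rightarrow> 'f::real_or_complex) \<Rightarrow> 'v topology" where
  "ip_topology H ip \<equiv> Metric_space.mtopology H (ip_dist H ip)"

(* The Hilbert space is a linear subspace H of an ambient vector space, so that H may consist of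
   functions.  The inner product ip matters on H only, and is linear in its first argument.
   The axiom ip_nonneg says that ip f f is a nonnegative real. *)
locale hilbert_space = vector_space scl
  for scl :: "'f::real_or_complex \<Rightarrow> 'v::ab_group_add \<Rightarrow> 'v" +
  fixes H :: "'v set" and ip :: "'v \<Rightarrow> 'v \<Rightarrow> 'f"
  assumes subspace_H: "subspace H"
    and ip_add_left: "\<lbrakk>f \<in> H; g \<in> H; h \<in> H\<rbrakk> \<Longrightarrow> ip (f + g) h = ip f h + ip g h"
    and ip_scale_left: "\<lbrakk>f \<in> H; g \<in> H\<rbrakk> \<Longrightarrow> ip (scl c f) g = c * ip f g"
    and ip_commute: "\<lbrakk>f \<in> H; g \<in> H\<rbrakk> \<Longrightarrow> ip f g = cj (ip g f)"
    and ip_nonneg: "f \<in> H \<Longrightarrow> ip f f = of_real (norm (ip f f))"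
    and ip_definite: "\<lbrakk>f \<in> H; ip f f = 0\<rbrakk> \<Longrightarrow> f = 0"
    and complete_H: "Metric_space.mcomplete H (ip_dist H ip)"
begin

lemma ip_add_right:
  assumes "f \<in> H" "g \<in> H" "h \<in> H"
  shows "ip h (f + g) = ip h f + ip h g"
  using assms subspace_H
  by (simp add: ip_commute[of h] ip_add_left cj_add subspace_add)

lemma ip_scale_right:
  assumes "f \<in> H" "h \<in> H"
  shows "ip h (scl c f) = cj c * ip h f"
  using assms subspace_H
  by (simp add: ip_commute[of h] ip_scale_left cj_mult subspace_scale)

lemma ip_norm_sq: "(ip_norm ip f)\<^sup>2 = norm (ip f f)"
  by (simp add: ip_norm_def)

lemma Cauchy_Schwarz:
  assumes f: "f \<in> H" and g: "g \<in> H"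
  shows "norm (ip f g) \<le> ip_norm ip f * ip_norm ip g"
proof (cases "ip g g = 0")
  case True
  then have "g = 0" using g ip_definite by blast
  then have "ip f g = 0" using ip_scale_right[OF g f, of 0] cj_of_real[of 0, where 'a='f] by simp
  then show ?thesis by (simp add: ip_norm_def)
next
  case False
  define q where "q = norm (ip g g)"
  define p where "p = norm (ip f f)"
  have q0: "q > 0" using False by (simp add: q_def)
  have qq: "ip g g = of_real q" and pp: "ip f f = of_real p"
    using ip_nonneg f g by (auto simp: q_def p_def)
  define c where "c = - ip f g * of_real (1 / q)"
  define h where "h = f + scl c g"
  have sg: "scl c g \<in> H" using g subspace_H subspace_scale by blast
  have hH: "h \<in> H" unfolding h_def using f sg subspace_H subspace_add by blast
  have cjc: "cj c = - ip g f * of_real (1 / q)"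
  proof -
    have "cj (- 1 :: 'f) = - 1"
      using cj_of_real[of "-1", where 'a='f] by simp
    moreover have "c = (- 1) * ip f g * of_real (1 / q)" by (simp add: c_def)
    ultimately show ?thesis
      by (simp only: cj_mult cj_of_real) (simp add: ip_commute[OF g f])
  qed
  have "ip h h = ip f f + cj c * ip f g + (c * ip g f + c * cj c * ip g g)"
    unfolding h_def using f g sg subspace_H
    by (simp add: ip_add_left ip_add_right ip_scale_left ip_scale_right subspace_add algebra_simps)
  also have "\<dots> = of_real p - ip f g * ip g f * of_real (1 / q)"
    unfolding cjc qq pp using q0 by (simp add: c_def field_simps)
  also have "ip f g * ip g f = of_real ((norm (ip f g))\<^sup>2)"
    using mult_cj[of "ip f g"] by (simp add: ip_commute[OF g f])
  finally have "ip h h = of_real (p - (norm (ip f g))\<^sup>2 * (1 / q))"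
    by (simp only: of_real_diff of_real_mult)
  with ip_nonneg[OF hH] have "norm (ip h h) = p - (norm (ip f g))\<^sup>2 * (1 / q)"
    by (metis of_real_eq_iff)
  then have "(norm (ip f g))\<^sup>2 = p * q - q * norm (ip h h)"
    using q0 by (simp add: field_simps)
  moreover have "0 \<le> q * norm (ip h h)"
    using q0 by simp
  ultimately have "(norm (ip f g))\<^sup>2 \<le> p * q"
    by linarith
  then have "norm (ip f g) \<le> sqrt (p * q)"
    by (rule real_le_rsqrt)
  then show ?thesis by (simp add: ip_norm_def p_def q_def real_sqrt_mult)
qed

lemma ip_norm_triangle:
  assumes f: "f \<in> H" and g: "g \<in> H"
  shows "ip_norm ip (f + g) \<le> ip_norm ip f + ip_norm ip g"
proof (rule power2_le_imp_le)
  have "ip (f + g) (f + g) = ip f f + ip g g + (ip f g + ip g f)"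
    using f g subspace_H
    by (simp add: ip_add_left ip_add_right subspace_add algebra_simps)
  then have "norm (ip (f + g) (f + g))
      \<le> norm (ip f f) + norm (ip g g) + (norm (ip f g) + norm (ip g f))"
    by (metis norm_triangle_le norm_triangle_mono norm_triangle_ineq)
  then have "norm (ip (f + g) (f + g))
      \<le> norm (ip f f) + norm (ip g g) + 2 * (ip_norm ip f * ip_norm ip g)"
    using Cauchy_Schwarz[OF f g] Cauchy_Schwarz[OF g f] by (simp add: mult.commute)
  then show "(ip_norm ip (f + g))\<^sup>2 \<le> (ip_norm ip f + ip_norm ip g)\<^sup>2"
    by (simp add: ip_norm_sq power2_sum)
qed (simp add: ip_norm_def)

lemma Metric_space_ip_dist: "Metric_space H (ip_dist H ip)"
proof
  show "0 \<le> ip_dist H ip f g" for f g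
    by (simp add: ip_dist_def ip_norm_def)
  show "ip_dist H ip f g = ip_dist H ip g f" for f g
  proof (cases "f \<in> H \<and> g \<in> H")
    case True
    then have d: "f - g \<in> H" using subspace_H subspace_diff by blast
    have c1: "cj (- 1 :: 'f) = - 1"
      using cj_of_real[of "-1", where 'a='f] by simp
    have "g - f = scl (- 1) (f - g)" by simp
    then have "ip (g - f) (g - f) = (- 1) * (cj (- 1) * ip (f - g) (f - g))"
      using d subspace_H by (metis ip_scale_left ip_scale_right subspace_scale)
    then show ?thesis using True by (simp add: ip_dist_def ip_norm_def c1)
  qed (auto simp: ip_dist_def)
  show "ip_dist H ip f g = 0 \<longleftrightarrow> f = g" if "f \<in> H" "g \<in> H" for f g
  proof
    assume "ip_dist H ip f g = 0"
    then have "ip (f - g) (f - g) = 0" using that by (simp add: ip_dist_def ip_norm_def)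
    moreover have "f - g \<in> H" using that subspace_H subspace_diff by blast
    ultimately show "f = g" using ip_definite[of "f - g"] by simp
  next
    assume "f = g"
    moreover have "ip 0 0 = 0"
      using ip_scale_left[OF subspace_0[OF subspace_H] subspace_0[OF subspace_H], of 0] by simp
    ultimately show "ip_dist H ip f g = 0" by (simp add: ip_dist_def ip_norm_def)
  qed
  show "ip_dist H ip f h \<le> ip_dist H ip f g + ip_dist H ip g h"
    if "f \<in> H" "g \<in> H" "h \<in> H" for f g h
    using ip_norm_triangle[of "f - g" "g - h"] that subspace_H
    by (simp add: ip_dist_def subspace_diff)
qed

end

definition separable_hilbert_space ::
    "('f::real_or_complex \<Rightarrow> 'v::ab_group_add \<Rightarrow> 'v) \<Rightarrow> 'v set \<Rightarrow> ('v \<Rightarrow> 'v \<Rightarrow> 'f) \<Rightarrow> bool" where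
  "separable_hilbert_space scl H ip \<longleftrightarrow>
     hilbert_space scl H ip \<and> separable_space (ip_topology H ip)"

definition closed_subspace ::
    "('f::real_or_complex \<Rightarrow> 'v::ab_group_add \<Rightarrow> 'v) \<Rightarrow> 'v set \<Rightarrow> ('v \<Rightarrow> 'v \<Rightarrow> 'f) \<Rightarrow> 'v set \<Rightarrow> bool"
  where
  "closed_subspace scl H ip U \<longleftrightarrow>
     U \<subseteq> H \<and> module.subspace scl U \<and> closedin (ip_topology H ip) U"

definition orth_proj ::
    "('v::ab_group_add \<Rightarrow> 'v \<Rightarrow> 'f::real_or_complex) \<Rightarrow> 'v set \<Rightarrow> 'v \<Rightarrow> 'v" where
  "orth_proj ip U f = (THE p. p \<in> U \<and> (\<forall>u\<in>U. ip (f - p) u = 0))"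

(* Unconditional sum in H, in the norm topology. *)
definition hilbert_sum ::
    "'v set \<Rightarrow> ('v::ab_group_add \<Rightarrow> 'v \<Rightarrow> 'f::real_or_complex) \<Rightarrow> ('j \<Rightarrow> 'v) \<Rightarrow> 'j set \<Rightarrow> 'v" where
  "hilbert_sum H ip g J =
     (THE s. limitin (ip_topology H ip) (\<lambda>F. \<Sum>j\<in>F. g j) s (finite_subsets_at_top J))"


definition frame_bounds ::
    "('v::ab_group_add \<Rightarrow> 'v \<Rightarrow> 'f::real_or_complex) \<Rightarrow> 'v set \<Rightarrow> 'j set \<Rightarrow> ('j \<Rightarrow> 'v)
      \<Rightarrow> real \<Rightarrow> real \<Rightarrow> bool" where
  "frame_bounds ip K J \<psi> A B \<longleftrightarrow>
     countable J \<and> (\<forall>j\<in>J. \<psi> j \<in> K) \<and> 0 < A \<and> A \<le> B \<and>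
     (\<forall>f\<in>K. (\<lambda>j. (norm (ip f (\<psi> j)))\<^sup>2) summable_on J \<and>
        A * (ip_norm ip f)\<^sup>2 \<le> (\<Sum>\<^sub>\<infinity>j\<in>J. (norm (ip f (\<psi> j)))\<^sup>2) \<and>
        (\<Sum>\<^sub>\<infinity>j\<in>J. (norm (ip f (\<psi> j)))\<^sup>2) \<le> B * (ip_norm ip f)\<^sup>2)"

definition frame ::
    "('v::ab_group_add \<Rightarrow> 'v \<Rightarrow> 'f::real_or_complex) \<Rightarrow> 'v set \<Rightarrow> 'j set \<Rightarrow> ('j \<Rightarrow> 'v) \<Rightarrow> bool"
  where "frame ip K J \<psi> \<longleftrightarrow> (\<exists>A B. frame_bounds ip K J \<psi> A B)"

definition A_tight_frame ::
    "real \<Rightarrow> ('v::ab_group_add \<Rightarrow> 'v \<Rightarrow> 'f::real_or_complex) \<Rightarrow> 'v set \<Rightarrow> 'j set \<Rightarrow> ('j \<Rightarrow> 'v)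
      \<Rightarrow> bool"
  where "A_tight_frame A ip K J \<psi> \<longleftrightarrow> frame_bounds ip K J \<psi> A A"

definition tight_frame ::
    "('v::ab_group_add \<Rightarrow> 'v \<Rightarrow> 'f::real_or_complex) \<Rightarrow> 'v set \<Rightarrow> 'j set \<Rightarrow> ('j \<Rightarrow> 'v) \<Rightarrow> bool"
  where "tight_frame ip K J \<psi> \<longleftrightarrow> (\<exists>A. A_tight_frame A ip K J \<psi>)"

definition parseval_frame ::
    "('v::ab_group_add \<Rightarrow> 'v \<Rightarrow> 'f::real_or_complex) \<Rightarrow> 'v set \<Rightarrow> 'j set \<Rightarrow> ('j \<Rightarrow> 'v) \<Rightarrow> bool"
  where "parseval_frame ip K J \<psi> \<longleftrightarrow> A_tight_frame 1 ip K J \<psi>"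

definition frame_operator ::
    "('f::real_or_complex \<Rightarrow> 'v::ab_group_add \<Rightarrow> 'v) \<Rightarrow> 'v set \<Rightarrow> ('v \<Rightarrow> 'v \<Rightarrow> 'f)
      \<Rightarrow> 'j set \<Rightarrow> ('j \<Rightarrow> 'v) \<Rightarrow> 'v \<Rightarrow> 'v" where
  "frame_operator scl H ip J \<psi> f = hilbert_sum H ip (\<lambda>j. scl (ip f (\<psi> j)) (\<psi> j)) J"


definition fusion_frame_bounds ::
    "('f::real_or_complex \<Rightarrow> 'v::ab_group_add \<Rightarrow> 'v) \<Rightarrow> 'v set \<Rightarrow> ('v \<Rightarrow> 'v \<Rightarrow> 'f)
      \<Rightarrow> 'i set \<Rightarrow> ('i \<Rightarrow> 'v set) \<Rightarrow> ('i \<Rightarrow> real) \<Rightarrow> real \<Rightarrow> real \<Rightarrow> bool" where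
  "fusion_frame_bounds scl H ip I V v A B \<longleftrightarrow>
     countable I \<and> (\<forall>i\<in>I. closed_subspace scl H ip (V i)) \<and> (\<forall>i\<in>I. 0 < v i) \<and>
     0 < A \<and> A \<le> B \<and>
     (\<forall>f\<in>H. (\<lambda>i. (v i)\<^sup>2 * (ip_norm ip (orth_proj ip (V i) f))\<^sup>2) summable_on I \<and>
        A * (ip_norm ip f)\<^sup>2 \<le> (\<Sum>\<^sub>\<infinity>i\<in>I. (v i)\<^sup>2 * (ip_norm ip (orth_proj ip (V i) f))\<^sup>2) \<and>
        (\<Sum>\<^sub>\<infinity>i\<in>I. (v i)\<^sup>2 * (ip_norm ip (orth_proj ip (V i) f))\<^sup>2) \<le> B * (ip_norm ip f)\<^sup>2)"

definition fusion_frame ::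
    "('f::real_or_complex \<Rightarrow> 'v::ab_group_add \<Rightarrow> 'v) \<Rightarrow> 'v set \<Rightarrow> ('v \<Rightarrow> 'v \<Rightarrow> 'f)
      \<Rightarrow> 'i set \<Rightarrow> ('i \<Rightarrow> 'v set) \<Rightarrow> ('i \<Rightarrow> real) \<Rightarrow> bool" where
  "fusion_frame scl H ip I V v \<longleftrightarrow> (\<exists>A B. fusion_frame_bounds scl H ip I V v A B)"

definition A_tight_fusion_frame ::
    "real \<Rightarrow> ('f::real_or_complex \<Rightarrow> 'v::ab_group_add \<Rightarrow> 'v) \<Rightarrow> 'v set \<Rightarrow> ('v \<Rightarrow> 'v \<Rightarrow> 'f)
      \<Rightarrow> 'i set \<Rightarrow> ('i \<Rightarrow> 'v set) \<Rightarrow> ('i \<Rightarrow> real) \<Rightarrow> bool" where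
  "A_tight_fusion_frame A scl H ip I V v \<longleftrightarrow> fusion_frame_bounds scl H ip I V v A A"

definition tight_fusion_frame ::
    "('f::real_or_complex \<Rightarrow> 'v::ab_group_add \<Rightarrow> 'v) \<Rightarrow> 'v set \<Rightarrow> ('v \<Rightarrow> 'v \<Rightarrow> 'f)
      \<Rightarrow> 'i set \<Rightarrow> ('i \<Rightarrow> 'v set) \<Rightarrow> ('i \<Rightarrow> real) \<Rightarrow> bool" where
  "tight_fusion_frame scl H ip I V v \<longleftrightarrow> (\<exists>A. A_tight_fusion_frame A scl H ip I V v)"

definition parseval_fusion_frame ::
    "('f::real_or_complex \<Rightarrow> 'v::ab_group_add \<Rightarrow> 'v) \<Rightarrow> 'v set \<Rightarrow> ('v \<Rightarrow> 'v \<Rightarrow> 'f)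
      \<Rightarrow> 'i set \<Rightarrow> ('i \<Rightarrow> 'v set) \<Rightarrow> ('i \<Rightarrow> real) \<Rightarrow> bool" where
  "parseval_fusion_frame scl H ip I V v \<longleftrightarrow> A_tight_fusion_frame 1 scl H ip I V v"

definition fusion_frame_operator ::
    "('f::real_or_complex \<Rightarrow> 'v::ab_group_add \<Rightarrow> 'v) \<Rightarrow> 'v set \<Rightarrow> ('v \<Rightarrow> 'v \<Rightarrow> 'f)
      \<Rightarrow> 'i set \<Rightarrow> ('i \<Rightarrow> 'v set) \<Rightarrow> ('i \<Rightarrow> real) \<Rightarrow> 'v \<Rightarrow> 'v" where
  "fusion_frame_operator scl H ip I V v f =
     hilbert_sum H ip (\<lambda>i. scl (of_real ((v i)\<^sup>2)) (orth_proj ip (V i) f)) I"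

definition fusion_frame_system ::
    "('f::real_or_complex \<Rightarrow> 'v::ab_group_add \<Rightarrow> 'v) \<Rightarrow> 'v set \<Rightarrow> ('v \<Rightarrow> 'v \<Rightarrow> 'f)
      \<Rightarrow> 'i set \<Rightarrow> ('i \<Rightarrow> 'v set) \<Rightarrow> ('i \<Rightarrow> real) \<Rightarrow> ('i \<Rightarrow> 'j set) \<Rightarrow> ('i \<Rightarrow> 'j \<Rightarrow> 'v) \<Rightarrow> bool" where
  "fusion_frame_system scl H ip I V v J \<phi> \<longleftrightarrow>
     fusion_frame scl H ip I V v \<and>
     (\<exists>A B. \<forall>i\<in>I. frame_bounds ip (V i) (J i) (\<phi> i) A B)"

(* The index set of the global frame is (SIGMA i:I. J i). *)
definition global_frame ::
    "('f::real_or_complex \<Rightarrow> 'v::ab_group_add \<Rightarrow> 'v) \<Rightarrow> ('i \<Rightarrow> real) \<Rightarrow> ('i \<Rightarrow> 'j \<Rightarrow> 'v)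
      \<Rightarrow> 'i \<times> 'j \<Rightarrow> 'v" where
  "global_frame scl v \<phi> = (\<lambda>(i, j). scl (of_real (v i)) (\<phi> i j))"


definition fun_scale :: "'f::real_or_complex \<Rightarrow> ('x \<Rightarrow> 'f) \<Rightarrow> 'x \<Rightarrow> 'f" where
  "fun_scale c f = (\<lambda>x. c * f x)"

(* A Hilbert space of functions on X, where X is the type 'x; addition of functions is pointwise
   by HOL-Library.Function_Algebras. *)
definition reproducing_kernel_hilbert_space ::
    "('x \<Rightarrow> 'f::real_or_complex) set \<Rightarrow> (('x \<Rightarrow> 'f) \<Rightarrow> ('x \<Rightarrow> 'f) \<Rightarrow> 'f) \<Rightarrow> bool" where
  "reproducing_kernel_hilbert_space H ip \<longleftrightarrow>
     hilbert_space fun_scale H ip \<and>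
     (\<forall>x. continuous_map (ip_topology H ip) euclidean (\<lambda>f. f x))"

definition multiplication_operator_on ::
    "('x \<Rightarrow> 'f::real_or_complex) set \<Rightarrow> (('x \<Rightarrow> 'f) \<Rightarrow> 'x \<Rightarrow> 'f) \<Rightarrow> bool" where
  "multiplication_operator_on H T \<longleftrightarrow> (\<exists>m. \<forall>f\<in>H. \<forall>x. T f x = m x * f x)"

definition painless_frame ::
    "('x \<Rightarrow> 'f::real_or_complex) set \<Rightarrow> (('x \<Rightarrow> 'f) \<Rightarrow> ('x \<Rightarrow> 'f) \<Rightarrow> 'f)
      \<Rightarrow> 'j set \<Rightarrow> ('j \<Rightarrow> 'x \<Rightarrow> 'f) \<Rightarrow> bool" where
  "painless_frame H ip J \<psi> \<longleftrightarrow>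
     frame ip H J \<psi> \<and> multiplication_operator_on H (frame_operator fun_scale H ip J \<psi>)"

definition painless_fusion_frame ::
    "('x \<Rightarrow> 'f::real_or_complex) set \<Rightarrow> (('x \<Rightarrow> 'f) \<Rightarrow> ('x \<Rightarrow> 'f) \<Rightarrow> 'f)
      \<Rightarrow> 'i set \<Rightarrow> ('i \<Rightarrow> ('x \<Rightarrow> 'f) set) \<Rightarrow> ('i \<Rightarrow> real) \<Rightarrow> bool" where
  "painless_fusion_frame H ip I V v \<longleftrightarrow>
     fusion_frame fun_scale H ip I V v \<and>
     multiplication_operator_on H (fusion_frame_operator fun_scale H ip I V v)"

end

theory Submission
  imports Defs
begin

text \<open>If the local frames are \<open>a\<close>-tight, the global frame operator is \<open>a\<close> times the fusion frame
  operator. Both operators are symmetric, so by polarization it suffices to compare their quadratic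
  forms, and this comparison is the identity
  \<open>\<Sum>\<^sub>j |\<langle>f, \<phi>\<^sub>i\<^sub>j\<rangle>|\<^sup>2 = a \<parallel>\<pi>\<^sub>i f\<parallel>\<^sup>2\<close>, weighted by \<open>v\<^sub>i\<^sup>2\<close> and summed over \<open>i\<close>; the same identity
  relates the frame bounds. Unconditional convergence of the operator sums follows from
  \<open>\<parallel>T f\<parallel>\<^sup>2 \<le> B \<langle>T f, f\<rangle>\<close> for positive operators \<open>T \<le> B\<close>.\<close>

section \<open>Arithmetic and continuity of the inner product\<close>

lemma cj_zero: "cj (0::'f::real_or_complex) = 0"
  using cj_of_real[of 0, where 'a = 'f] by simp

context hilbert_space
begin

lemmas H_diff = subspace_diff[OF subspace_H]
  and H_scale = subspace_scale[OF subspace_H]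
  and H_sum = subspace_sum[OF subspace_H]

lemma ip_zero_left: "g \<in> H \<Longrightarrow> ip 0 g = 0"
  using ip_scale_left[of g g 0] by simp

lemma ip_zero_right: "g \<in> H \<Longrightarrow> ip g 0 = 0"
  using ip_scale_right[of g g 0] by (simp add: cj_zero)

lemma ip_diff_left: "\<lbrakk>f \<in> H; g \<in> H; h \<in> H\<rbrakk> \<Longrightarrow> ip (f - g) h = ip f h - ip g h"
  using ip_add_left[of "f - g" g h] by (simp add: H_diff)

lemma ip_diff_right: "\<lbrakk>f \<in> H; g \<in> H; h \<in> H\<rbrakk> \<Longrightarrow> ip h (f - g) = ip h f - ip h g"
  using ip_add_right[of "f - g" g h] by (simp add: H_diff)

lemma ip_sum_left:
  assumes "\<And>j. j \<in> F \<Longrightarrow> x j \<in> H" "g \<in> H"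
  shows "ip (\<Sum>j\<in>F. x j) g = (\<Sum>j\<in>F. ip (x j) g)"
  using assms
  by (induction F rule: infinite_finite_induct) (auto simp: ip_zero_left ip_add_left H_sum)

lemma ip_sum_right:
  assumes "\<And>j. j \<in> F \<Longrightarrow> x j \<in> H" "g \<in> H"
  shows "ip g (\<Sum>j\<in>F. x j) = (\<Sum>j\<in>F. ip g (x j))"
  using assms
  by (induction F rule: infinite_finite_induct) (auto simp: ip_zero_right ip_add_right H_sum)

lemma ip_self: "f \<in> H \<Longrightarrow> ip f f = of_real ((ip_norm ip f)\<^sup>2)"
  using ip_nonneg by (simp add: ip_norm_sq)

lemma tendsto_ip_left:
  assumes "limitin (ip_topology H ip) X s Fl" and g: "g \<in> H"
  shows "((\<lambda>i. ip (X i) g) \<longlongrightarrow> ip s g) Fl"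
proof -
  interpret M: Metric_space H "ip_dist H ip" by (rule Metric_space_ip_dist)
  have s: "s \<in> H" and X: "eventually (\<lambda>i. X i \<in> H) Fl"
    and d: "((\<lambda>i. ip_dist H ip (X i) s) \<longlongrightarrow> 0) Fl"
    using assms by (auto simp: M.limitin_metric_dist_null)
  have "((\<lambda>i. ip_dist H ip (X i) s * ip_norm ip g) \<longlongrightarrow> 0) Fl"
    using tendsto_mult_right[OF d, of "ip_norm ip g"] by simp
  then have "((\<lambda>i. ip (X i) g - ip s g) \<longlongrightarrow> 0) Fl"
  proof (rule Lim_null_comparison[rotated])
    show "eventually (\<lambda>i. norm (ip (X i) g - ip s g) \<le> ip_dist H ip (X i) s * ip_norm ip g) Fl"
      using X
    proof eventually_elim
      case (elim i)
      then show ?case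
        using Cauchy_Schwarz[of "X i - s" g] s g by (simp add: ip_dist_def ip_diff_left H_diff)
    qed
  qed
  then show ?thesis by (simp add: Lim_null[symmetric])
qed

lemma tendsto_ip_right:
  assumes "limitin (ip_topology H ip) X s Fl" and g: "g \<in> H"
  shows "((\<lambda>i. ip g (X i)) \<longlongrightarrow> ip g s) Fl"
proof -
  interpret M: Metric_space H "ip_dist H ip" by (rule Metric_space_ip_dist)
  have s: "s \<in> H" and X: "eventually (\<lambda>i. X i \<in> H) Fl"
    and d: "((\<lambda>i. ip_dist H ip (X i) s) \<longlongrightarrow> 0) Fl"
    using assms by (auto simp: M.limitin_metric_dist_null)
  have "((\<lambda>i. ip_norm ip g * ip_dist H ip (X i) s) \<longlongrightarrow> 0) Fl"
    using tendsto_mult_left[OF d, of "ip_norm ip g"] by simp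
  then have "((\<lambda>i. ip g (X i) - ip g s) \<longlongrightarrow> 0) Fl"
  proof (rule Lim_null_comparison[rotated])
    show "eventually (\<lambda>i. norm (ip g (X i) - ip g s) \<le> ip_norm ip g * ip_dist H ip (X i) s) Fl"
      using X
    proof eventually_elim
      case (elim i)
      then show ?case
        using Cauchy_Schwarz[of g "X i - s"] s g by (simp add: ip_dist_def ip_diff_right H_diff)
    qed
  qed
  then show ?thesis by (simp add: Lim_null[symmetric])
qed

text \<open>Limits in a metric space are unique along the nontrivial filter
  \<open>finite_subsets_at_top J\<close>, so the description in \<open>hilbert_sum\<close> picks out
  any limit that is exhibited.\<close>

lemma hilbert_sum_eqI:
  assumes "limitin (ip_topology H ip) (\<lambda>F. \<Sum>j\<in>F. x j) s (finite_subsets_at_top J)"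
  shows "hilbert_sum H ip x J = s"
proof -
  interpret M: Metric_space H "ip_dist H ip" by (rule Metric_space_ip_dist)
  show ?thesis
    unfolding hilbert_sum_def
    using assms by (rule the_equality) (rule M.limitin_metric_unique[OF _ assms], auto)
qed

section \<open>Positive operators\<close>

text \<open>The equation with \<open>of_real\<close> and \<open>norm\<close> encodes that the
  quadratic form takes nonnegative real values. Symmetry is a separate clause because over the reals
  nonnegativity does not imply it.\<close>

definition positive_op :: "('v \<Rightarrow> 'v) \<Rightarrow> bool" where
  "positive_op T \<longleftrightarrow>
     (\<forall>f\<in>H. T f \<in> H \<and> ip (T f) f = of_real (norm (ip (T f) f))) \<and>
     (\<forall>f\<in>H. \<forall>g\<in>H. ip (T f) g = ip f (T g))"

lemma
  assumes "positive_op T" "f \<in> H"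
  shows positive_op_mem: "T f \<in> H"
    and positive_op_nonneg: "ip (T f) f = of_real (norm (ip (T f) f))"
    and positive_op_symm: "g \<in> H \<Longrightarrow> ip (T f) g = ip f (T g)"
  using assms by (auto simp: positive_op_def)

text \<open>Nonnegative reals add without cancellation, so \<open>norm\<close> commutes with the
  sum.\<close>

lemma norm_ip_sum_positive_op:
  assumes T: "\<And>j. j \<in> F \<Longrightarrow> positive_op (T j)" and f: "f \<in> H"
  shows "norm (ip (\<Sum>j\<in>F. T j f) f) = (\<Sum>j\<in>F. norm (ip (T j f) f))"
    and "ip (\<Sum>j\<in>F. T j f) f = of_real (\<Sum>j\<in>F. norm (ip (T j f) f))"
proof -
  have "ip (\<Sum>j\<in>F. T j f) f = (\<Sum>j\<in>F. ip (T j f) f)"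
    using T f by (simp add: ip_sum_left positive_op_mem)
  also have "\<dots> = (\<Sum>j\<in>F. of_real (norm (ip (T j f) f)))"
    using T f by (intro sum.cong refl) (auto intro: positive_op_nonneg)
  finally show 1: "ip (\<Sum>j\<in>F. T j f) f = of_real (\<Sum>j\<in>F. norm (ip (T j f) f))"
    by simp
  show "norm (ip (\<Sum>j\<in>F. T j f) f) = (\<Sum>j\<in>F. norm (ip (T j f) f))"
    unfolding 1 norm_of_real by (simp add: sum_nonneg)
qed

lemma positive_op_sum:
  assumes T: "\<And>j. j \<in> F \<Longrightarrow> positive_op (T j)"
  shows "positive_op (\<lambda>f. \<Sum>j\<in>F. T j f)"
  unfolding positive_op_def
proof (intro conjI ballI)
  fix f assume f: "f \<in> H"
  show "(\<Sum>j\<in>F. T j f) \<in> H" using T f by (intro H_sum) (rule positive_op_mem)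
  show "ip (\<Sum>j\<in>F. T j f) f = of_real (norm (ip (\<Sum>j\<in>F. T j f) f))"
    using norm_ip_sum_positive_op[of F T f] T f by metis
  fix g assume g: "g \<in> H"
  show "ip (\<Sum>j\<in>F. T j f) g = ip f (\<Sum>j\<in>F. T j g)"
    using T f g by (simp add: ip_sum_left ip_sum_right positive_op_mem positive_op_symm)
qed

text \<open>Positivity of \<open>T\<close> at \<open>f - T f / B\<close> replaces the Cauchy--Schwarz inequality for the
  semidefinite form of \<open>T\<close>.\<close>
lemma positive_op_bound:
  assumes T: "positive_op T" and f: "f \<in> H" and "0 < B"
    and B: "norm (ip (T (T f)) (T f)) \<le> B * (ip_norm ip (T f))\<^sup>2"
  shows "(ip_norm ip (T f))\<^sup>2 \<le> B * norm (ip (T f) f)"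
proof -
  define w where "w = T f"
  define n m q where "n = (ip_norm ip w)\<^sup>2" and "m = norm (ip (T w) w)" and "q = norm (ip w f)"
  define g where "g = f - scl (of_real (1 / B)) w"
  have w: "w \<in> H" and Tw: "T w \<in> H" and cw: "scl (of_real (1 / B)) w \<in> H"
    using T f by (auto simp: w_def positive_op_mem H_scale)
  then have g: "g \<in> H" and Tg: "T g \<in> H" using T f by (auto simp: g_def H_diff positive_op_mem)
  have ww: "ip w w = of_real n" using w by (simp add: n_def ip_self)
  have Tww: "ip (T w) w = of_real m" "ip w (T w) = of_real m"
    using positive_op_nonneg[OF T w] positive_op_symm[OF T w w] by (simp_all add: m_def)
  have fw: "ip f w = of_real q"
    using positive_op_nonneg[OF T f] positive_op_symm[OF T f f] by (simp add: q_def w_def)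
  have "ip f (T w) = of_real n"
    using positive_op_symm[OF T f w] ww by (simp add: w_def)
  then have Tgw: "ip (T g) w = of_real (n - m / B)"
    using f w Tw cw positive_op_symm[OF T g w]
    by (simp add: g_def ip_diff_left ip_scale_left Tww)
  have Tgf: "ip (T g) f = of_real (q - n / B)"
    using f w cw positive_op_symm[OF T g f] ww fw
    by (simp add: g_def ip_diff_left ip_scale_left w_def)
  have "ip (T g) g = ip (T g) f - of_real (1 / B) * ip (T g) w"
    using f w cw Tg
    by (subst (2) g_def) (simp add: ip_diff_right ip_scale_right cj_of_real del: of_real_divide)
  also have "\<dots> = of_real (q - n / B - 1 / B * (n - m / B))"
    by (simp only: Tgw Tgf of_real_diff of_real_mult)
  finally have "norm (ip (T g) g) = q - n / B - 1 / B * (n - m / B)"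
    using positive_op_nonneg[OF T g] by (metis of_real_eq_iff)
  then have "0 \<le> q - n / B - 1 / B * (n - m / B)" by (metis norm_ge_zero)
  \<comment> \<open>The value of the form at \<open>g\<close> is
    \<open>q - 2 * n / B + m / (B * B)\<close>. Since \<open>m / B\<close> is at most
    \<open>n\<close>, it is bounded above by \<open>q - n / B\<close>, whose nonnegativity is the
    claim.\<close>
  also have "m / B \<le> n"
    using B \<open>0 < B\<close> by (simp add: m_def n_def w_def field_simps)
  then have "q - n / B - 1 / B * (n - m / B) \<le> q - n / B"
    using \<open>0 < B\<close> by simp
  finally show ?thesis
    using \<open>0 < B\<close> by (simp add: n_def q_def w_def field_simps)
qed

text \<open>Polarization at the single vector \<open>u + w\<close> with \<open>w = D u\<close>: the
  diagonal terms vanish and symmetry makes both cross terms equal to \<open>ip w w\<close>, so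
  \<open>2 * ip w w = 0\<close>. Symmetry also does the work of linearity, moving \<open>D\<close>
  to the other argument before anything is expanded. The subspace \<open>U\<close> is later a local
  space or all of \<open>H\<close>.\<close>

lemma symmetric_eq_0:
  assumes U: "U \<subseteq> H" "subspace U" and D: "\<And>u. u \<in> U \<Longrightarrow> D u \<in> U"
    and symm: "\<And>u w. \<lbrakk>u \<in> U; w \<in> U\<rbrakk> \<Longrightarrow> ip (D u) w = ip u (D w)"
    and 0: "\<And>u. u \<in> U \<Longrightarrow> ip (D u) u = 0" and u: "u \<in> U"
  shows "D u = 0"
proof -
  define w where "w = D u"
  have w: "w \<in> U" "D w \<in> U" and g: "u + w \<in> U" "D (u + w) \<in> U"
    using D u U by (auto simp: w_def subspace_add)
  note mem = u w g subsetD[OF U(1)]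
  have "0 = ip (D (u + w)) u + ip (D (u + w)) w"
    using 0[OF g(1)] mem by (simp add: ip_add_right)
  also have "\<dots> = ip (u + w) w + ip (u + w) (D w)"
    using symm[OF g(1) u] symm[OF g(1) w(1)] by (simp add: w_def)
  also have "\<dots> = ip u w + ip w w + (ip u (D w) + ip w (D w))"
    using mem by (simp add: ip_add_left)
  also have "ip u w = 0" using symm[OF u u] 0[OF u] by (simp add: w_def)
  also have "ip w (D w) = 0" using symm[OF w(1) w(1)] 0[OF w(1)] by simp
  also have "ip u (D w) = ip w w" using symm[OF u w(1)] by (simp add: w_def)
  finally have "ip w w = 0" by (simp flip: mult_2)
  then show ?thesis using ip_definite mem by (simp add: w_def)
qed

section \<open>Unconditional sums of positive operators with bounded forms\<close>

context
  fixes T :: "'j \<Rightarrow> 'v \<Rightarrow> 'v" and J :: "'j set" and U :: "'v set" and B :: real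
  assumes U: "U \<subseteq> H" "subspace U" and B: "0 < B"
    and T: "\<And>j. j \<in> J \<Longrightarrow> positive_op (T j)"
    and T_mem: "\<And>j f. \<lbrakk>j \<in> J; f \<in> H\<rbrakk> \<Longrightarrow> T j f \<in> U"
    and bound: "\<And>F g. \<lbrakk>finite F; F \<subseteq> J; g \<in> U\<rbrakk> \<Longrightarrow>
      (\<Sum>j\<in>F. norm (ip (T j g) g)) \<le> B * (ip_norm ip g)\<^sup>2"
begin

text \<open>The hypothesis \<open>bound\<close> is available on \<open>U\<close> only, but
  \<open>positive_op_bound\<close> consults it just at the partial sum itself, which lies in
  \<open>U\<close> for every \<open>f\<close> in \<open>H\<close>. This lets a local frame act on
  all of \<open>H\<close>.\<close>

lemma norm_partial_sum_bound:
  assumes F: "finite F" "F \<subseteq> J" and f: "f \<in> H"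
  shows "(ip_norm ip (\<Sum>j\<in>F. T j f))\<^sup>2 \<le> B * (\<Sum>j\<in>F. norm (ip (T j f) f))"
proof -
  have T': "positive_op (T j)" if "j \<in> F" for j using that F T by blast
  have S: "positive_op (\<lambda>f. \<Sum>j\<in>F. T j f)" using T' by (rule positive_op_sum)
  have mem: "(\<Sum>j\<in>F. T j f) \<in> U"
    using F f T_mem by (intro subspace_sum[OF U(2)]) blast
  then have memH: "(\<Sum>j\<in>F. T j f) \<in> H" using U by blast
  show ?thesis
    using positive_op_bound[OF S f B] bound[OF F mem]
    by (simp add: norm_ip_sum_positive_op(1)[OF T' f] norm_ip_sum_positive_op(1)[OF T' memH])
qed

text \<open>Cauchy-Schwarz and \<open>norm_partial_sum_bound\<close> give
  \<open>Q\<^sup>2 \<le> B * Q * (ip_norm ip f)\<^sup>2\<close> for the sum \<open>Q\<close>;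
  cancelling one factor \<open>Q\<close> carries the bound from \<open>U\<close> to
  \<open>H\<close>.\<close>

lemma partial_sum_bound:
  assumes F: "finite F" "F \<subseteq> J" and f: "f \<in> H"
  shows "(\<Sum>j\<in>F. norm (ip (T j f) f)) \<le> B * (ip_norm ip f)\<^sup>2"
proof -
  have T': "positive_op (T j)" if "j \<in> F" for j using that F T by blast
  define Q where "Q = (\<Sum>j\<in>F. norm (ip (T j f) f))"
  have mem: "(\<Sum>j\<in>F. T j f) \<in> H"
    using T' f by (intro H_sum) (rule positive_op_mem)
  have "Q \<le> ip_norm ip (\<Sum>j\<in>F. T j f) * ip_norm ip f"
    using Cauchy_Schwarz[OF mem f] by (simp add: Q_def norm_ip_sum_positive_op(1)[OF T' f])
  moreover have Q0: "0 \<le> Q" by (simp add: Q_def sum_nonneg)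
  ultimately have "Q\<^sup>2 \<le> (ip_norm ip (\<Sum>j\<in>F. T j f))\<^sup>2 * (ip_norm ip f)\<^sup>2"
    by (metis power_mono power_mult_distrib)
  also have "\<dots> \<le> (B * Q) * (ip_norm ip f)\<^sup>2"
    unfolding Q_def by (intro mult_right_mono norm_partial_sum_bound F f) simp
  finally have "Q * Q \<le> Q * (B * (ip_norm ip f)\<^sup>2)"
    by (simp add: power2_eq_square mult_ac)
  then have "Q \<le> B * (ip_norm ip f)\<^sup>2"
    using Q0 B by (cases "Q = 0") auto
  then show ?thesis by (simp add: Q_def)
qed

lemma summable_positive_ops:
  assumes f: "f \<in> H"
  shows "(\<lambda>j. norm (ip (T j f) f)) summable_on J"
proof (rule nonneg_bdd_above_summable_on)
  show "bdd_above (sum (\<lambda>j. norm (ip (T j f) f)) ` {F. F \<subseteq> J \<and> finite F})"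
    using partial_sum_bound[OF _ _ f] by (intro bdd_aboveI[of _ "B * (ip_norm ip f)\<^sup>2"]) auto
qed simp

text \<open>By \<open>norm_partial_sum_bound\<close> the squared norm of a finite block of terms is
  at most \<open>B\<close> times the same block of the summable series \<open>q\<close>, so the
  partial sums form a Cauchy net. Completeness speaks of sequences, hence the limit is found along a
  sequence of finite sets and then extended to the whole net.\<close>

lemma limitin_positive_ops:
  assumes f: "f \<in> H"
  shows "limitin (ip_topology H ip) (\<lambda>F. \<Sum>j\<in>F. T j f) (hilbert_sum H ip (\<lambda>j. T j f) J)
    (finite_subsets_at_top J)"
proof -
  interpret M: Metric_space H "ip_dist H ip" by (rule Metric_space_ip_dist)
  define q where "q j = norm (ip (T j f) f)" for j
  define X where "X F = (\<Sum>j\<in>F. T j f)" for F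
  have XH: "X F \<in> H" if "F \<subseteq> J" for F
    unfolding X_def using that T f by (intro H_sum) (rule positive_op_mem, auto)
  have q0: "0 \<le> q j" for j by (simp add: q_def)
  have "q summable_on J" using summable_positive_ops[OF f] by (simp add: q_def[abs_def])
  then have q: "(q has_sum infsum q J) J" by simp
  \<comment> \<open>The tail is kept below \<open>e\<^sup>2 / B\<close> so that the factor
    \<open>B\<close> leaves \<open>e\<^sup>2\<close> for the squared norm in
    \<open>close\<close>.\<close>
  have ex: "\<exists>G. finite G \<and> G \<subseteq> J \<and> infsum q J - sum q G < e\<^sup>2 / B" if "0 < e" for e
  proof -
    have "eventually (\<lambda>F. dist (sum q F) (infsum q J) < e\<^sup>2 / B) (finite_subsets_at_top J)"
      using q that B unfolding has_sum_def by (intro tendstoD) auto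
    then obtain G where "finite G" "G \<subseteq> J" "dist (sum q G) (infsum q J) < e\<^sup>2 / B"
      unfolding eventually_finite_subsets_at_top by blast
    then show ?thesis by (auto simp: dist_real_def)
  qed
  have close: "ip_dist H ip (X F) (X G) < e"
    if G: "finite G" "G \<subseteq> J" "infsum q J - sum q G < e\<^sup>2 / B"
      and F: "finite F" "F \<subseteq> J" "G \<subseteq> F" and e: "0 < e" for F G e
  proof -
    have "X F - X G = X (F - G)"
      using F G by (simp add: X_def sum_diff)
    then have "(ip_norm ip (X F - X G))\<^sup>2 \<le> B * sum q (F - G)"
      using norm_partial_sum_bound[of "F - G" f] F f by (auto simp: X_def q_def)
    also have "sum q (F - G) = sum q F - sum q G"
      using F G by (simp add: sum_diff)
    also have "\<dots> < e\<^sup>2 / B"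
      using finite_sum_le_has_sum[OF q F(1,2)] q0 G(3) by auto
    finally have "(ip_norm ip (X F - X G))\<^sup>2 < e\<^sup>2"
      using B by (simp add: field_simps)
    then have "ip_norm ip (X F - X G) < e"
      using e by (simp add: power_less_imp_less_base)
    then show ?thesis using XH F G by (simp add: ip_dist_def)
  qed
  have "\<exists>G. \<forall>n. finite (G n) \<and> G n \<subseteq> J \<and> infsum q J - sum q (G n) < (1 / Suc n)\<^sup>2 / B"
    using ex by (intro choice) simp
  then obtain G0 where G0: "finite (G0 n)" "G0 n \<subseteq> J"
      "infsum q J - sum q (G0 n) < (1 / Suc n)\<^sup>2 / B" for n :: nat by blast
  \<comment> \<open>Unions make the sets increasing, so \<open>near\<close> compares any two later
    ones through an earlier one; the tails of \<open>q\<close> only shrink.\<close>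
  define G where "G n = (\<Union>k\<le>n. G0 k)" for n
  have G: "finite (G n)" "G n \<subseteq> J" for n using G0 by (auto simp: G_def)
  have G_mono: "G m \<subseteq> G n" if "m \<le> n" for m n
    unfolding G_def using that by (intro UN_mono) auto
  have G_q: "infsum q J - sum q (G n) < (1 / Suc n)\<^sup>2 / B" for n
  proof -
    have "sum q (G0 n) \<le> sum q (G n)"
      using G q0 by (intro sum_mono2) (auto simp: G_def)
    then show ?thesis using G0(3)[of n] by linarith
  qed
  have near: "ip_dist H ip (X F) (X (G n)) < 1 / Suc n"
    if "finite F" "F \<subseteq> J" "G n \<subseteq> F" for F n
    using close[OF G G_q that] by simp
  have "M.MCauchy (\<lambda>n. X (G n))"
    unfolding M.MCauchy_def
  proof (intro conjI allI impI)
    fix e :: real assume "0 < e"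
    then obtain N where N: "1 / real (Suc N) < e / 2" using nat_approx_posE by (metis half_gt_zero)
    have N2: "ip_dist H ip (X (G n)) (X (G N)) < e / 2" if "N \<le> n" for n
      using near[OF G(1,2) G_mono[OF that]] N by linarith
    have "ip_dist H ip (X (G n)) (X (G n')) < e" if "N \<le> n" "N \<le> n'" for n n'
      using M.triangle[of "X (G n)" "X (G N)" "X (G n')"] N2[OF that(1)] N2[OF that(2)] XH G
        M.commute[of "X (G N)"] by fastforce
    then show "\<exists>N. \<forall>n n'. N \<le> n \<longrightarrow> N \<le> n' \<longrightarrow> ip_dist H ip (X (G n)) (X (G n')) < e"
      by blast
  qed (use XH G in blast)
  then obtain s where s: "limitin M.mtopology (\<lambda>n. X (G n)) s sequentially"
    using complete_H M.mcomplete_def by blast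
  have sH: "s \<in> H" using s M.limitin_mspace by blast
  have "limitin M.mtopology X s (finite_subsets_at_top J)"
    unfolding M.limitin_metric
  proof (intro conjI allI impI sH)
    fix e :: real assume e: "0 < e"
    then obtain N where N: "1 / real (Suc N) < e / 2" using nat_approx_posE by (metis half_gt_zero)
    have "eventually (\<lambda>n. ip_dist H ip (X (G n)) s < e / 2) sequentially"
      using s half_gt_zero[OF e] unfolding M.limitin_metric eventually_conj_iff by blast
    \<comment> \<open>One index \<open>n\<close> has to serve twice: \<open>X (G n)\<close> is
      within \<open>e / 2\<close> of \<open>s\<close> and, by \<open>near\<close>, of every
      \<open>X F\<close> with \<open>F\<close> containing \<open>G n\<close>.\<close>
    then have "eventually (\<lambda>n. N \<le> n \<and> ip_dist H ip (X (G n)) s < e / 2) sequentially"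
      by (intro eventually_conj eventually_ge_at_top)
    then obtain n where n: "N \<le> n" "ip_dist H ip (X (G n)) s < e / 2"
      by (auto simp: eventually_sequentially)
    have "1 / real (Suc n) \<le> 1 / real (Suc N)" using n by (simp add: frac_le)
    then have "ip_dist H ip (X F) s < e" if "finite F" "F \<subseteq> J" "G n \<subseteq> F" for F
      using M.triangle[of "X F" "X (G n)" s] near[OF that] n N XH that G sH by fastforce
    then show "eventually (\<lambda>F. X F \<in> H \<and> ip_dist H ip (X F) s < e) (finite_subsets_at_top J)"
      unfolding eventually_finite_subsets_at_top using G[of n] XH by (intro exI[of _ "G n"]) auto
  qed
  then show ?thesis
    using hilbert_sum_eqI[of "\<lambda>j. T j f" s J] by (simp add: X_def[abs_def])
qed

text \<open>This brings the values of a local frame operator, formed for arbitrary vectors of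
  \<open>H\<close>, back into the closed subspace.\<close>

lemma hilbert_sum_mem_closed:
  assumes "f \<in> H" "closedin (ip_topology H ip) U"
  shows "hilbert_sum H ip (\<lambda>j. T j f) J \<in> U"
proof (rule limitin_closedin[OF limitin_positive_ops[OF assms(1)] assms(2)])
  show "eventually (\<lambda>F. (\<Sum>j\<in>F. T j f) \<in> U) (finite_subsets_at_top J)"
    using T_mem assms(1) U
    by (intro eventually_finite_subsets_at_top_weakI subspace_sum) blast+
qed simp

text \<open>Continuity of the inner product turns the limit of vectors into a numerical sum; frame
  operators are compared through this formula.\<close>

lemma ip_hilbert_sum_self:
  assumes f: "f \<in> H"
  shows "ip (hilbert_sum H ip (\<lambda>j. T j f) J) f = of_real (\<Sum>\<^sub>\<infinity>j\<in>J. norm (ip (T j f) f))"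
proof (rule tendsto_unique)
  show "((\<lambda>F. ip (\<Sum>j\<in>F. T j f) f) \<longlongrightarrow> ip (hilbert_sum H ip (\<lambda>j. T j f) J) f)
      (finite_subsets_at_top J)"
    by (rule tendsto_ip_left[OF limitin_positive_ops[OF f] f])
  have "((\<lambda>F. of_real (\<Sum>j\<in>F. norm (ip (T j f) f)) :: 'f) \<longlongrightarrow>
      of_real (\<Sum>\<^sub>\<infinity>j\<in>J. norm (ip (T j f) f))) (finite_subsets_at_top J)"
    using summable_positive_ops[OF f]
    by (intro tendsto_of_real) (simp flip: has_sum_def)
  moreover have "eventually (\<lambda>F. ip (\<Sum>j\<in>F. T j f) f = of_real (\<Sum>j\<in>F. norm (ip (T j f) f)))
      (finite_subsets_at_top J)"
    using T by (intro eventually_finite_subsets_at_top_weakI norm_ip_sum_positive_op(2) f) blast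
  ultimately show "((\<lambda>F. ip (\<Sum>j\<in>F. T j f) f) \<longlongrightarrow>
      of_real (\<Sum>\<^sub>\<infinity>j\<in>J. norm (ip (T j f) f))) (finite_subsets_at_top J)"
    by (subst tendsto_cong)
qed simp

lemma positive_op_hilbert_sum: "positive_op (\<lambda>f. hilbert_sum H ip (\<lambda>j. T j f) J)"
  unfolding positive_op_def
proof (intro conjI ballI)
  interpret M: Metric_space H "ip_dist H ip" by (rule Metric_space_ip_dist)
  fix f assume f: "f \<in> H"
  show "hilbert_sum H ip (\<lambda>j. T j f) J \<in> H"
    using limitin_positive_ops[OF f] by (rule M.limitin_mspace)
  have "0 \<le> (\<Sum>\<^sub>\<infinity>j\<in>J. norm (ip (T j f) f))" by (simp add: infsum_nonneg)
  then show "ip (hilbert_sum H ip (\<lambda>j. T j f) J) f =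
      of_real (norm (ip (hilbert_sum H ip (\<lambda>j. T j f) J) f))"
    by (simp add: ip_hilbert_sum_self[OF f])
  fix g assume g: "g \<in> H"
  show "ip (hilbert_sum H ip (\<lambda>j. T j f) J) g = ip f (hilbert_sum H ip (\<lambda>j. T j g) J)"
  proof (rule tendsto_unique)
    show "((\<lambda>F. ip f (\<Sum>j\<in>F. T j g)) \<longlongrightarrow> ip f (hilbert_sum H ip (\<lambda>j. T j g) J))
        (finite_subsets_at_top J)"
      by (rule tendsto_ip_right[OF limitin_positive_ops[OF g] f])
    have "eventually (\<lambda>F. ip (\<Sum>j\<in>F. T j f) g = ip f (\<Sum>j\<in>F. T j g)) (finite_subsets_at_top J)"
      using T by (intro eventually_finite_subsets_at_top_weakI
          positive_op_symm[OF positive_op_sum f g]) blast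
    then show "((\<lambda>F. ip f (\<Sum>j\<in>F. T j g)) \<longlongrightarrow> ip (hilbert_sum H ip (\<lambda>j. T j f) J) g)
        (finite_subsets_at_top J)"
      using tendsto_ip_left[OF limitin_positive_ops[OF f] g]
      by (rule Lim_transform_eventually[rotated])
  qed simp
qed

end

section \<open>Rank-one operators and frame operators\<close>

lemma
  assumes \<psi>: "\<psi> \<in> H"
  shows positive_op_rank_one: "positive_op (\<lambda>f. scl (ip f \<psi>) \<psi>)"
    and norm_ip_rank_one: "f \<in> H \<Longrightarrow> norm (ip (scl (ip f \<psi>) \<psi>) f) = (norm (ip f \<psi>))\<^sup>2"
proof -
  have left: "ip (scl (ip f \<psi>) \<psi>) g = ip f \<psi> * ip \<psi> g" if "f \<in> H" "g \<in> H" for f g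
    using \<psi> that by (simp add: ip_scale_left)
  have right: "ip f (scl (ip g \<psi>) \<psi>) = ip \<psi> g * ip f \<psi>" if "f \<in> H" "g \<in> H" for f g
    using \<psi> that by (simp add: ip_scale_right flip: ip_commute[of \<psi> g])
  have self: "ip (scl (ip f \<psi>) \<psi>) f = of_real ((norm (ip f \<psi>))\<^sup>2)" if "f \<in> H" for f
    using mult_cj[of "ip f \<psi>"] \<psi> that by (simp add: left flip: ip_commute[of \<psi> f])
  show norm: "norm (ip (scl (ip f \<psi>) \<psi>) f) = (norm (ip f \<psi>))\<^sup>2" if "f \<in> H" for f
    unfolding self[OF that] norm_of_real by simp
  show "positive_op (\<lambda>f. scl (ip f \<psi>) \<psi>)"
    unfolding positive_op_def
  proof (intro conjI ballI)
    fix f assume f: "f \<in> H"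
    show "scl (ip f \<psi>) \<psi> \<in> H" using \<psi> by (rule H_scale)
    show "ip (scl (ip f \<psi>) \<psi>) f = of_real (norm (ip (scl (ip f \<psi>) \<psi>) f))"
      unfolding norm[OF f] by (rule self[OF f])
    show "ip (scl (ip f \<psi>) \<psi>) g = ip f (scl (ip g \<psi>) \<psi>)" if "g \<in> H" for g
      using f that by (simp add: left right mult.commute)
  qed
qed

text \<open>This supplies the hypothesis \<open>bound\<close> for sums of rank-one operators. The
  space \<open>K\<close> is kept separate from \<open>H\<close> so that the estimate serves both
  frames of \<open>H\<close> and local frames.\<close>

lemma frame_bounds_partial_sum:
  assumes "frame_bounds ip K J \<psi> A B" "finite F" "F \<subseteq> J" "g \<in> K" "K \<subseteq> H"
  shows "(\<Sum>j\<in>F. norm (ip (scl (ip g (\<psi> j)) (\<psi> j)) g)) \<le> B * (ip_norm ip g)\<^sup>2"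
proof -
  have \<psi>: "\<psi> j \<in> H" if "j \<in> F" for j
    using assms that unfolding frame_bounds_def by blast
  have "(\<Sum>j\<in>F. norm (ip (scl (ip g (\<psi> j)) (\<psi> j)) g)) = (\<Sum>j\<in>F. (norm (ip g (\<psi> j)))\<^sup>2)"
    using \<psi> assms(4,5) by (intro sum.cong refl norm_ip_rank_one) auto
  also have "\<dots> \<le> (\<Sum>\<^sub>\<infinity>j\<in>J. (norm (ip g (\<psi> j)))\<^sup>2)"
    using assms unfolding frame_bounds_def by (intro finite_sum_le_infsum) auto
  also have "\<dots> \<le> B * (ip_norm ip g)\<^sup>2"
    using assms unfolding frame_bounds_def by blast
  finally show ?thesis .
qed

lemma
  assumes "frame_bounds ip H J \<psi> A B"
  shows positive_op_frame_operator: "positive_op (frame_operator scl H ip J \<psi>)"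
    and ip_frame_operator_self: "f \<in> H \<Longrightarrow>
      ip (frame_operator scl H ip J \<psi> f) f = of_real (\<Sum>\<^sub>\<infinity>j\<in>J. (norm (ip f (\<psi> j)))\<^sup>2)"
proof -
  have B: "0 < B" and \<psi>: "\<And>j. j \<in> J \<Longrightarrow> \<psi> j \<in> H"
    using assms by (auto simp: frame_bounds_def)
  let ?T = "\<lambda>j f. scl (ip f (\<psi> j)) (\<psi> j)"
  note * = order_refl subspace_H B positive_op_rank_one[OF \<psi>] H_scale[OF \<psi>]
    frame_bounds_partial_sum[OF assms _ _ _ order_refl]
  show "positive_op (frame_operator scl H ip J \<psi>)"
    using positive_op_hilbert_sum[of H B J ?T, OF *] by (simp add: frame_operator_def[abs_def])
  show "ip (frame_operator scl H ip J \<psi> f) f = of_real (\<Sum>\<^sub>\<infinity>j\<in>J. (norm (ip f (\<psi> j)))\<^sup>2)"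
    if f: "f \<in> H"
  proof -
    have "(\<Sum>\<^sub>\<infinity>j\<in>J. norm (ip (?T j f) f)) = (\<Sum>\<^sub>\<infinity>j\<in>J. (norm (ip f (\<psi> j)))\<^sup>2)"
      using \<psi> f by (intro infsum_cong norm_ip_rank_one)
    then show ?thesis
      using ip_hilbert_sum_self[of H B J ?T f, OF * f] by (simp add: frame_operator_def)
  qed
qed

section \<open>Orthogonal projections\<close>

text \<open>The difference of two candidates lies in \<open>U\<close> and is orthogonal to
  \<open>U\<close>, hence to itself, so the description in \<open>orth_proj\<close> is
  unique.\<close>

lemma orth_proj_eqI:
  assumes U: "U \<subseteq> H" "subspace U" and f: "f \<in> H" and p: "p \<in> U"
    and orth: "\<And>u. u \<in> U \<Longrightarrow> ip (f - p) u = 0"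
  shows "orth_proj ip U f = p"
  unfolding orth_proj_def
proof (rule the_equality)
  show "p \<in> U \<and> (\<forall>u\<in>U. ip (f - p) u = 0)" using p orth by blast
  fix p' assume p': "p' \<in> U \<and> (\<forall>u\<in>U. ip (f - p') u = 0)"
  have d: "p' - p \<in> U" using p p' U by (simp add: subspace_diff)
  have "p' - p = (f - p) - (f - p')" by simp
  moreover have "f - p \<in> H" "f - p' \<in> H" "p' - p \<in> H"
    using f p p' d U by (auto intro: H_diff)
  ultimately have "ip (p' - p) (p' - p) = ip (f - p) (p' - p) - ip (f - p') (p' - p)"
    using ip_diff_left by metis
  also have "\<dots> = 0" using orth[OF d] p' d by simp
  finally show "p' = p" using ip_definite[of "p' - p"] d U by auto
qed

text \<open>For a tight frame of \<open>U\<close> the projection onto \<open>U\<close> is a multiple of the extension of the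
  frame operator to \<open>H\<close>, so its existence needs no minimization argument.\<close>
lemma
  assumes U: "closed_subspace scl H ip U" and tight: "A_tight_frame a ip U J \<psi>"
    and f: "f \<in> H"
  shows tight_frame_orth_proj_mem: "orth_proj ip U f \<in> U"
    and tight_frame_orth_proj_orth: "u \<in> U \<Longrightarrow> ip (f - orth_proj ip U f) u = 0"
    and tight_frame_has_sum:
      "((\<lambda>j. (norm (ip f (\<psi> j)))\<^sup>2) has_sum a * (ip_norm ip (orth_proj ip U f))\<^sup>2) J"
proof -
  have UH: "U \<subseteq> H" and sub: "subspace U" and closed: "closedin (ip_topology H ip) U"
    using U by (auto simp: closed_subspace_def)
  have fb: "frame_bounds ip U J \<psi> a a" using tight by (simp add: A_tight_frame_def)
  then have a: "0 < a" and \<psi>U: "\<And>j. j \<in> J \<Longrightarrow> \<psi> j \<in> U"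
    and tight_sum: "\<And>g. g \<in> U \<Longrightarrow>
      (\<Sum>\<^sub>\<infinity>j\<in>J. (norm (ip g (\<psi> j)))\<^sup>2) = a * (ip_norm ip g)\<^sup>2"
    by (auto simp: frame_bounds_def intro: antisym)
  have \<psi>: "\<psi> j \<in> H" if "j \<in> J" for j using \<psi>U[OF that] UH by blast
  let ?T = "\<lambda>j f. scl (ip f (\<psi> j)) (\<psi> j)"
  define S where "S f = hilbert_sum H ip (\<lambda>j. ?T j f) J" for f
  note * = UH sub a positive_op_rank_one[OF \<psi>] subspace_scale[OF sub \<psi>U]
    frame_bounds_partial_sum[OF fb _ _ _ UH]
  have S: "positive_op S"
    using positive_op_hilbert_sum[of U a J ?T, OF *] by (simp add: S_def[abs_def])
  have SU: "S g \<in> U" if "g \<in> H" for g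
    using hilbert_sum_mem_closed[of U a J ?T g, OF * that closed] by (simp add: S_def)
  have norm_T: "norm (ip (?T j g) g) = (norm (ip g (\<psi> j)))\<^sup>2" if "j \<in> J" "g \<in> H" for j g
    using norm_ip_rank_one[OF \<psi>] that by blast
  have S_self: "ip (S g) g = of_real (\<Sum>\<^sub>\<infinity>j\<in>J. (norm (ip g (\<psi> j)))\<^sup>2)" if "g \<in> H" for g
    using ip_hilbert_sum_self[of U a J ?T g, OF * that] infsum_cong[OF norm_T[OF _ that]]
    by (simp add: S_def)
  \<comment> \<open>On \<open>U\<close> the operator \<open>S - a\<close> is symmetric, and
    tightness makes its quadratic form vanish, so it is zero by polarization.\<close>
  have S_U: "S u = scl (of_real a) u" if u: "u \<in> U" for u
  proof -
    have "S u - scl (of_real a) u = 0"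
    proof (rule symmetric_eq_0[OF UH sub _ _ _ u])
      fix x assume x: "x \<in> U"
      have xH: "x \<in> H" "S x \<in> H" "scl (of_real a) x \<in> H" using x UH SU by (auto intro: H_scale)
      show "S x - scl (of_real a) x \<in> U"
        using x UH by (intro subspace_diff[OF sub] SU subspace_scale[OF sub]) auto
      show "ip (S x - scl (of_real a) x) x = 0"
        using xH by (simp add: ip_diff_left ip_scale_left S_self tight_sum[OF x] ip_self[of x])
      fix y assume "y \<in> U"
      then have yH: "y \<in> H" "S y \<in> H" "scl (of_real a) y \<in> H" using UH SU by (auto intro: H_scale)
      show "ip (S x - scl (of_real a) x) y = ip x (S y - scl (of_real a) y)"
        using xH yH positive_op_symm[OF S xH(1) yH(1)]
        by (simp add: ip_diff_left ip_diff_right ip_scale_left ip_scale_right cj_of_real)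
    qed
    then show ?thesis by simp
  qed
  \<comment> \<open>The factor comes from \<open>ip (S f) u = ip f (S u) = a * ip f u\<close> for
    \<open>u\<close> in \<open>U\<close>: division by \<open>a\<close> makes \<open>f - p\<close>
    orthogonal to \<open>U\<close>.\<close>
  define p where "p = scl (of_real (1 / a)) (S f)"
  have p: "p \<in> U" unfolding p_def by (intro subspace_scale[OF sub] SU f)
  have Sf: "S f \<in> H" using SU[OF f] UH by blast
  have orth: "ip (f - p) u = 0" if u: "u \<in> U" for u
  proof -
    have uH: "u \<in> H" using u UH by blast
    have "ip (S f) u = of_real a * ip f u"
      using positive_op_symm[OF S f uH] f uH by (simp add: S_U[OF u] ip_scale_right cj_of_real)
    then have "ip p u = ip f u" using a Sf uH by (simp add: p_def ip_scale_left)
    then show ?thesis using p UH f uH by (auto simp: ip_diff_left)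
  qed
  have P: "orth_proj ip U f = p" by (rule orth_proj_eqI[OF UH sub f p orth])
  show "orth_proj ip U f \<in> U" using p P by simp
  show "u \<in> U \<Longrightarrow> ip (f - orth_proj ip U f) u = 0" using orth P by simp
  have pH: "p \<in> H" using p UH by blast
  \<comment> \<open>Orthogonality of \<open>f - p\<close> to \<open>p\<close> turns the form of
    \<open>S\<close> at \<open>f\<close>, which is \<open>a * ip p f\<close>, into \<open>a\<close>
    times the squared norm of the projection.\<close>
  have "ip p f = ip p p"
  proof -
    have "ip p (f - p) = 0"
      using orth[OF p] ip_commute[of p "f - p"] pH f by (simp add: H_diff cj_zero)
    then show ?thesis using pH f by (simp add: ip_diff_right)
  qed
  moreover have "ip (S f) f = of_real a * ip p f"
    using a Sf f by (simp add: p_def ip_scale_left)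
  ultimately have "ip (S f) f = of_real (a * (ip_norm ip p)\<^sup>2)"
    using ip_self[OF pH] by simp
  then have "(\<Sum>\<^sub>\<infinity>j\<in>J. (norm (ip f (\<psi> j)))\<^sup>2) = a * (ip_norm ip p)\<^sup>2"
    unfolding S_self[OF f] of_real_eq_iff .
  \<comment> \<open>The frame bounds give summability for vectors of \<open>U\<close>; for
    \<open>f\<close> in \<open>H\<close> it comes from the theory of positive operators.\<close>
  moreover have "(\<lambda>j. norm (ip (?T j f) f)) summable_on J"
    by (rule summable_positive_ops[of U a J ?T f, OF * f])
  then have "(\<lambda>j. (norm (ip f (\<psi> j)))\<^sup>2) summable_on J"
    by (subst (asm) summable_on_cong[OF norm_T[OF _ f]])
  ultimately show "((\<lambda>j. (norm (ip f (\<psi> j)))\<^sup>2) has_sum a * (ip_norm ip (orth_proj ip U f))\<^sup>2) J"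
    unfolding P using has_sum_infsum by metis
qed

text \<open>Orthogonality makes both \<open>ip f (orth_proj ip U g)\<close> and
  \<open>ip (orth_proj ip U f) g\<close> equal to the inner product of the two projections, whence
  symmetry and positivity. Existence of the projections enters as a hypothesis, to be supplied by
  the tight local frames.\<close>

lemma
  assumes U: "U \<subseteq> H"
    and mem: "\<And>f. f \<in> H \<Longrightarrow> orth_proj ip U f \<in> U"
    and orth: "\<And>f u. \<lbrakk>f \<in> H; u \<in> U\<rbrakk> \<Longrightarrow> ip (f - orth_proj ip U f) u = 0"
    and r: "0 \<le> r"
  shows positive_op_scale_orth_proj: "positive_op (\<lambda>f. scl (of_real r) (orth_proj ip U f))"
    and norm_ip_scale_orth_proj: "f \<in> H \<Longrightarrow>
      norm (ip (scl (of_real r) (orth_proj ip U f)) f) = r * (ip_norm ip (orth_proj ip U f))\<^sup>2"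
proof -
  have P: "orth_proj ip U f \<in> H" if "f \<in> H" for f using mem[OF that] U by blast
  have right: "ip f (orth_proj ip U g) = ip (orth_proj ip U f) (orth_proj ip U g)"
    if "f \<in> H" "g \<in> H" for f g
    using orth[OF that(1) mem[OF that(2)]] that P by (simp add: ip_diff_left)
  have left: "ip (orth_proj ip U f) g = ip (orth_proj ip U f) (orth_proj ip U g)"
    if "f \<in> H" "g \<in> H" for f g
    using right[OF that(2,1)] that P by (metis ip_commute)
  have self: "ip (scl (of_real r) (orth_proj ip U f)) f =
      of_real (r * (ip_norm ip (orth_proj ip U f))\<^sup>2)" if "f \<in> H" for f
    using that P by (simp add: ip_scale_left left[of f f] ip_self)
  show norm: "norm (ip (scl (of_real r) (orth_proj ip U f)) f) =
      r * (ip_norm ip (orth_proj ip U f))\<^sup>2" if "f \<in> H" for f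
    unfolding self[OF that] norm_of_real using r by simp
  have "ip (scl (of_real r) (orth_proj ip U f)) g = ip f (scl (of_real r) (orth_proj ip U g))"
    if "f \<in> H" "g \<in> H" for f g
    using that P by (simp add: ip_scale_left ip_scale_right cj_of_real left[of f g] right[of f g])
  then show "positive_op (\<lambda>f. scl (of_real r) (orth_proj ip U f))"
    unfolding positive_op_def using P self norm by (auto intro: H_scale)
qed

section \<open>The global frame over \<open>a\<close>-tight local frames\<close>

context
  fixes I :: "'i set" and V :: "'i \<Rightarrow> 'v set" and v :: "'i \<Rightarrow> real"
    and J :: "'i \<Rightarrow> 'j set" and \<phi> :: "'i \<Rightarrow> 'j \<Rightarrow> 'v" and a :: real
  assumes fusion: "fusion_frame scl H ip I V v" and a: "0 < a"
    and tight: "\<And>i. i \<in> I \<Longrightarrow> A_tight_frame a ip (V i) (J i) (\<phi> i)"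
begin

lemma V_closed: "i \<in> I \<Longrightarrow> closed_subspace scl H ip (V i)"
  using fusion by (auto simp: fusion_frame_def fusion_frame_bounds_def)

lemma V_subset: "i \<in> I \<Longrightarrow> V i \<subseteq> H"
  using V_closed by (auto simp: closed_subspace_def)

lemma local_frame_mem: "\<lbrakk>i \<in> I; j \<in> J i\<rbrakk> \<Longrightarrow> \<phi> i j \<in> H"
  using tight[of i] V_subset[of i] by (auto simp: A_tight_frame_def frame_bounds_def)

lemma fusion_summable:
  "f \<in> H \<Longrightarrow> (\<lambda>i. (v i)\<^sup>2 * (ip_norm ip (orth_proj ip (V i) f))\<^sup>2) summable_on I"
  using fusion by (auto simp: fusion_frame_def fusion_frame_bounds_def)

text \<open>The terms are nonnegative, so the sum over pairs can be taken fibre by fibre.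
  \<open>tight_frame_has_sum\<close> evaluates the inner sums, and the outer one converges because
  \<open>V\<close> is a fusion frame.\<close>

lemma global_frame_has_sum:
  assumes f: "f \<in> H"
  shows "((\<lambda>k. (norm (ip f (global_frame scl v \<phi> k)))\<^sup>2) has_sum
    a * (\<Sum>\<^sub>\<infinity>i\<in>I. (v i)\<^sup>2 * (ip_norm ip (orth_proj ip (V i) f))\<^sup>2)) (SIGMA i:I. J i)"
proof -
  let ?h = "\<lambda>k. (norm (ip f (global_frame scl v \<phi> k)))\<^sup>2"
  let ?w = "\<lambda>i. (v i)\<^sup>2 * (ip_norm ip (orth_proj ip (V i) f))\<^sup>2"
  have h: "?h (i, j) = (v i)\<^sup>2 * (norm (ip f (\<phi> i j)))\<^sup>2" if "i \<in> I" "j \<in> J i" for i j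
    using local_frame_mem[OF that] f
    by (simp add: global_frame_def ip_scale_right cj_of_real norm_mult power_mult_distrib)
  have inner: "((\<lambda>j. ?h (i, j)) has_sum a * ?w i) (J i)" if i: "i \<in> I" for i
  proof -
    have "((\<lambda>j. (v i)\<^sup>2 * (norm (ip f (\<phi> i j)))\<^sup>2) has_sum
        (v i)\<^sup>2 * (a * (ip_norm ip (orth_proj ip (V i) f))\<^sup>2)) (J i)"
      by (intro has_sum_cmult_right tight_frame_has_sum V_closed tight i f)
    then show ?thesis
      by (subst has_sum_cong[OF h[OF i]]) (auto simp: mult_ac)
  qed
  have "((\<lambda>i. a * ?w i) has_sum a * infsum ?w I) I"
    by (intro has_sum_cmult_right has_sum_infsum fusion_summable f)
  then show ?thesis
    by (intro has_sum_SigmaI[OF inner] summable_on_SigmaI[OF inner])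
      (auto intro: has_sum_imp_summable)
qed

text \<open>By \<open>global_frame_has_sum\<close> the two sums of squares differ by the factor
  \<open>a\<close>; as \<open>a\<close> is positive, the inequalities can be scaled in either
  direction.\<close>

lemma fusion_frame_bounds_iff_global:
  "fusion_frame_bounds scl H ip I V v C D \<longleftrightarrow>
     frame_bounds ip H (SIGMA i:I. J i) (global_frame scl v \<phi>) (a * C) (a * D)"
proof -
  have "countable I" and v: "\<And>i. i \<in> I \<Longrightarrow> 0 < v i"
    using fusion by (auto simp: fusion_frame_def fusion_frame_bounds_def)
  have "\<And>i. i \<in> I \<Longrightarrow> countable (J i)"
    using tight by (auto simp: A_tight_frame_def frame_bounds_def)
  with \<open>countable I\<close> have countable: "countable (SIGMA i:I. J i)" by (rule countable_SIGMA)
  have mem: "global_frame scl v \<phi> k \<in> H" if "k \<in> (SIGMA i:I. J i)" for k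
    using that local_frame_mem by (auto simp: global_frame_def intro: H_scale)
  show ?thesis
    unfolding fusion_frame_bounds_def frame_bounds_def
    using a \<open>countable I\<close> v countable mem V_closed fusion_summable
      has_sum_imp_summable[OF global_frame_has_sum] infsumI[OF global_frame_has_sum]
    by (simp add: zero_less_mult_iff mult.assoc)
qed

lemma A_tight_fusion_frame_iff_global:
  "A_tight_fusion_frame C scl H ip I V v \<longleftrightarrow>
     A_tight_frame (a * C) ip H (SIGMA i:I. J i) (global_frame scl v \<phi>)"
  by (simp add: A_tight_fusion_frame_def A_tight_frame_def fusion_frame_bounds_iff_global)

lemma tight_fusion_frame_iff_global:
  "tight_fusion_frame scl H ip I V v \<longleftrightarrow>
     tight_frame ip H (SIGMA i:I. J i) (global_frame scl v \<phi>)"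
proof -
  \<comment> \<open>The constant \<open>C / a\<close> reaches every tightness constant
    \<open>C\<close> of the global frame, as the converse direction requires.\<close>
  have "A_tight_fusion_frame (C / a) scl H ip I V v \<longleftrightarrow>
      A_tight_frame C ip H (SIGMA i:I. J i) (global_frame scl v \<phi>)" for C
    using a by (simp add: A_tight_fusion_frame_iff_global)
  then show ?thesis
    unfolding tight_fusion_frame_def tight_frame_def
    using A_tight_fusion_frame_iff_global by metis
qed

lemma global_frame: "frame ip H (SIGMA i:I. J i) (global_frame scl v \<phi>)"
  using fusion fusion_frame_bounds_iff_global unfolding fusion_frame_def frame_def by blast

text \<open>The projections exist because each \<open>V i\<close> carries a tight local frame; the
  upper fusion bound \<open>D\<close> then controls the partial sums of the forms, with
  \<open>U\<close> taken to be \<open>H\<close>.\<close>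

lemma
  shows positive_op_fusion_frame_operator: "positive_op (fusion_frame_operator scl H ip I V v)"
    and ip_fusion_frame_operator_self: "f \<in> H \<Longrightarrow>
      ip (fusion_frame_operator scl H ip I V v f) f =
        of_real (\<Sum>\<^sub>\<infinity>i\<in>I. (v i)\<^sup>2 * (ip_norm ip (orth_proj ip (V i) f))\<^sup>2)"
proof -
  obtain C D where CD: "fusion_frame_bounds scl H ip I V v C D"
    using fusion unfolding fusion_frame_def by blast
  then have D: "0 < D" by (auto simp: fusion_frame_bounds_def)
  let ?T = "\<lambda>i f. scl (of_real ((v i)\<^sup>2)) (orth_proj ip (V i) f)"
  have P: "positive_op (?T i)" if "i \<in> I" for i
    using that by (intro positive_op_scale_orth_proj V_subset)
      (auto intro: tight_frame_orth_proj_mem tight_frame_orth_proj_orth V_closed tight)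
  have norm_T: "norm (ip (?T i f) f) = (v i)\<^sup>2 * (ip_norm ip (orth_proj ip (V i) f))\<^sup>2"
    if "i \<in> I" "f \<in> H" for i f
    using that by (intro norm_ip_scale_orth_proj V_subset)
      (auto intro: tight_frame_orth_proj_mem tight_frame_orth_proj_orth V_closed tight)
  have bound: "(\<Sum>i\<in>F. norm (ip (?T i g) g)) \<le> D * (ip_norm ip g)\<^sup>2"
    if "finite F" "F \<subseteq> I" "g \<in> H" for F g
  proof -
    have "(\<Sum>i\<in>F. norm (ip (?T i g) g)) =
        (\<Sum>i\<in>F. (v i)\<^sup>2 * (ip_norm ip (orth_proj ip (V i) g))\<^sup>2)"
      using that by (intro sum.cong refl norm_T) auto
    also have "\<dots> \<le> (\<Sum>\<^sub>\<infinity>i\<in>I. (v i)\<^sup>2 * (ip_norm ip (orth_proj ip (V i) g))\<^sup>2)"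
      using that by (intro finite_sum_le_infsum fusion_summable) auto
    also have "\<dots> \<le> D * (ip_norm ip g)\<^sup>2"
      using CD that(3) unfolding fusion_frame_bounds_def by blast
    finally show ?thesis .
  qed
  note * = order_refl subspace_H D P positive_op_mem[OF P] bound
  show "positive_op (fusion_frame_operator scl H ip I V v)"
    using positive_op_hilbert_sum[of H D I ?T, OF *] by (simp add: fusion_frame_operator_def[abs_def])
  show "ip (fusion_frame_operator scl H ip I V v f) f =
      of_real (\<Sum>\<^sub>\<infinity>i\<in>I. (v i)\<^sup>2 * (ip_norm ip (orth_proj ip (V i) f))\<^sup>2)" if f: "f \<in> H"
    using ip_hilbert_sum_self[of H D I ?T f, OF * f] infsum_cong[OF norm_T[OF _ f]]
    by (simp add: fusion_frame_operator_def)
qed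

text \<open>Comparing quadratic forms avoids regrouping a vector-valued double series: only the
  numerical sum in \<open>global_frame_has_sum\<close> is regrouped, and
  \<open>symmetric_eq_0\<close> recovers the operators.\<close>

lemma frame_operator_global_frame:
  assumes f: "f \<in> H"
  shows "frame_operator scl H ip (SIGMA i:I. J i) (global_frame scl v \<phi>) f =
    scl (of_real a) (fusion_frame_operator scl H ip I V v f)"
proof -
  let ?G = "frame_operator scl H ip (SIGMA i:I. J i) (global_frame scl v \<phi>)"
  let ?V = "fusion_frame_operator scl H ip I V v"
  obtain C D where CD: "frame_bounds ip H (SIGMA i:I. J i) (global_frame scl v \<phi>) C D"
    using global_frame unfolding frame_def by blast
  note G = positive_op_frame_operator[OF CD]
  note V = positive_op_fusion_frame_operator
  have mem: "?G x \<in> H" "?V x \<in> H" "scl (of_real a) (?V x) \<in> H" if "x \<in> H" for x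
    using that G V by (auto intro: positive_op_mem H_scale)
  have "?G f - scl (of_real a) (?V f) = 0"
  proof (rule symmetric_eq_0[OF order_refl subspace_H _ _ _ f])
    fix x assume x: "x \<in> H"
    show "?G x - scl (of_real a) (?V x) \<in> H" using mem x by (auto intro: H_diff)
    show "ip (?G x - scl (of_real a) (?V x)) x = 0"
      using x mem[OF x] ip_frame_operator_self[OF CD x] ip_fusion_frame_operator_self[OF x]
        infsumI[OF global_frame_has_sum[OF x]]
      by (simp add: ip_diff_left ip_scale_left)
    fix y assume y: "y \<in> H"
    show "ip (?G x - scl (of_real a) (?V x)) y = ip x (?G y - scl (of_real a) (?V y))"
      using x y mem[OF x] mem[OF y] positive_op_symm[OF G x y] positive_op_symm[OF V x y]
      by (simp add: ip_diff_left ip_diff_right ip_scale_left ip_scale_right cj_of_real)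
  qed
  then show ?thesis by simp
qed

end

end

section \<open>Painlessness and the five equivalences\<close>

text \<open>Evaluated at each point, the operator identity relates the two multipliers by the factor
  \<open>a\<close>, which is nonzero and can be divided out.\<close>

lemma painless_fusion_frame_iff_global:
  assumes H: "hilbert_space fun_scale H ip" and fusion: "fusion_frame fun_scale H ip I V v"
    and a: "0 < a" and tight: "\<And>i. i \<in> I \<Longrightarrow> A_tight_frame a ip (V i) (J i) (\<phi> i)"
  shows "painless_fusion_frame H ip I V v \<longleftrightarrow>
    painless_frame H ip (SIGMA i:I. J i) (global_frame fun_scale v \<phi>)"
proof -
  interpret hilbert_space fun_scale H ip by (rule H)
  let ?G = "frame_operator fun_scale H ip (SIGMA i:I. J i) (global_frame fun_scale v \<phi>)"
  let ?V = "fusion_frame_operator fun_scale H ip I V v"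
  have eq: "?G f x = of_real a * ?V f x" if "f \<in> H" for f x
    using frame_operator_global_frame[OF fusion a tight that] by (simp add: fun_scale_def)
  have "multiplication_operator_on H ?V \<longleftrightarrow> multiplication_operator_on H ?G"
  proof
    assume "multiplication_operator_on H ?V"
    then obtain m where "\<forall>f\<in>H. \<forall>x. ?V f x = m x * f x"
      unfolding multiplication_operator_on_def by blast
    then have "\<forall>f\<in>H. \<forall>x. ?G f x = (of_real a * m x) * f x" by (simp add: eq mult.assoc)
    then show "multiplication_operator_on H ?G"
      unfolding multiplication_operator_on_def by (rule exI[of _ "\<lambda>x. of_real a * m x"])
  next
    assume "multiplication_operator_on H ?G"
    then obtain m where "\<forall>f\<in>H. \<forall>x. ?G f x = m x * f x"
      unfolding multiplication_operator_on_def by blast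
    then have "\<forall>f\<in>H. \<forall>x. ?V f x = (m x / of_real a) * f x"
      using a by (simp add: eq field_simps)
    then show "multiplication_operator_on H ?V"
      unfolding multiplication_operator_on_def by (rule exI[of _ "\<lambda>x. m x / of_real a"])
  qed
  then show ?thesis
    using fusion global_frame[OF fusion a tight]
    by (simp add: painless_fusion_frame_def painless_frame_def)
qed

theorem corollary4p11:
  fixes scl :: "'f::real_or_complex \<Rightarrow> 'v::ab_group_add \<Rightarrow> 'v"
    and H :: "'v set" and ip :: "'v \<Rightarrow> 'v \<Rightarrow> 'f"
    and I :: "'i set" and V :: "'i \<Rightarrow> 'v set" and v :: "'i \<Rightarrow> real"
    and J :: "'i \<Rightarrow> 'j set" and \<phi> :: "'i \<Rightarrow> 'j \<Rightarrow> 'v"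
    and R :: "('x \<Rightarrow> 'f) set" and ipR :: "('x \<Rightarrow> 'f) \<Rightarrow> ('x \<Rightarrow> 'f) \<Rightarrow> 'f"
    and W :: "'i \<Rightarrow> ('x \<Rightarrow> 'f) set" and \<theta> :: "'i \<Rightarrow> 'j \<Rightarrow> 'x \<Rightarrow> 'f"
  shows
    "(separable_hilbert_space scl H ip \<and> fusion_frame_system scl H ip I V v J \<phi> \<longrightarrow>
        ((\<forall>i\<in>I. parseval_frame ip (V i) (J i) (\<phi> i)) \<longrightarrow>
           (parseval_fusion_frame scl H ip I V v \<longleftrightarrow>
            parseval_frame ip H (SIGMA i:I. J i) (global_frame scl v \<phi>))) \<and>
        (\<forall>A>0. (\<forall>i\<in>I. parseval_frame ip (V i) (J i) (\<phi> i)) \<longrightarrow>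
           (A_tight_fusion_frame A scl H ip I V v \<longleftrightarrow>
            A_tight_frame A ip H (SIGMA i:I. J i) (global_frame scl v \<phi>))) \<and>
        (\<forall>A>0. (\<forall>i\<in>I. A_tight_frame A ip (V i) (J i) (\<phi> i)) \<longrightarrow>
           (tight_fusion_frame scl H ip I V v \<longleftrightarrow>
            tight_frame ip H (SIGMA i:I. J i) (global_frame scl v \<phi>))))
     \<and>
     (separable_hilbert_space fun_scale R ipR \<and> reproducing_kernel_hilbert_space R ipR \<and>
      fusion_frame_system fun_scale R ipR I W v J \<theta> \<longrightarrow>
        ((\<forall>i\<in>I. parseval_frame ipR (W i) (J i) (\<theta> i)) \<longrightarrow>
           (painless_fusion_frame R ipR I W v \<longleftrightarrow>
            painless_frame R ipR (SIGMA i:I. J i) (global_frame fun_scale v \<theta>))) \<and>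
        (\<forall>A>0. (\<forall>i\<in>I. A_tight_frame A ipR (W i) (J i) (\<theta> i)) \<longrightarrow>
           (painless_fusion_frame R ipR I W v \<longleftrightarrow>
            painless_frame R ipR (SIGMA i:I. J i) (global_frame fun_scale v \<theta>))))"
proof (intro conjI impI allI)
  assume "separable_hilbert_space scl H ip \<and> fusion_frame_system scl H ip I V v J \<phi>"
  then interpret hilbert_space scl H ip by (simp add: separable_hilbert_space_def)
  have fusion: "fusion_frame scl H ip I V v"
    using \<open>_ \<and> fusion_frame_system scl H ip I V v J \<phi>\<close> by (simp add: fusion_frame_system_def)
  \<comment> \<open>Parseval local frames are the case \<open>a = 1\<close>, where the two tightness
    constants coincide. The Parseval equivalence that follows is the instance \<open>A = 1\<close>
    of this one.\<close>
  show "A_tight_fusion_frame A scl H ip I V v \<longleftrightarrow>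
      A_tight_frame A ip H (SIGMA i:I. J i) (global_frame scl v \<phi>)"
    if "\<forall>i\<in>I. parseval_frame ip (V i) (J i) (\<phi> i)" for A
    using A_tight_fusion_frame_iff_global[OF fusion zero_less_one, of J \<phi> A] that
    by (simp add: parseval_frame_def)
  then show "parseval_fusion_frame scl H ip I V v \<longleftrightarrow>
      parseval_frame ip H (SIGMA i:I. J i) (global_frame scl v \<phi>)"
    if "\<forall>i\<in>I. parseval_frame ip (V i) (J i) (\<phi> i)"
    using that by (simp add: parseval_fusion_frame_def parseval_frame_def)
  show "tight_fusion_frame scl H ip I V v \<longleftrightarrow>
      tight_frame ip H (SIGMA i:I. J i) (global_frame scl v \<phi>)"
    if "0 < A" "\<forall>i\<in>I. A_tight_frame A ip (V i) (J i) (\<phi> i)" for A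
    using tight_fusion_frame_iff_global[OF fusion that(1)] that(2) by blast
next
  assume R: "separable_hilbert_space fun_scale R ipR \<and> reproducing_kernel_hilbert_space R ipR \<and>
    fusion_frame_system fun_scale R ipR I W v J \<theta>"
  then have H: "hilbert_space fun_scale R ipR" and fusion: "fusion_frame fun_scale R ipR I W v"
    by (simp_all add: separable_hilbert_space_def fusion_frame_system_def)
  show "painless_fusion_frame R ipR I W v \<longleftrightarrow>
      painless_frame R ipR (SIGMA i:I. J i) (global_frame fun_scale v \<theta>)"
    if "0 < A" "\<forall>i\<in>I. A_tight_frame A ipR (W i) (J i) (\<theta> i)" for A
    using painless_fusion_frame_iff_global[OF H fusion that(1)] that(2) by blast
  \<comment> \<open>A Parseval frame is by definition a tight frame with constant
    \<open>1\<close>.\<close>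
  from this[of 1] show "painless_fusion_frame R ipR I W v \<longleftrightarrow>
      painless_frame R ipR (SIGMA i:I. J i) (global_frame fun_scale v \<theta>)"
    if "\<forall>i\<in>I. parseval_frame ipR (W i) (J i) (\<theta> i)"
    using that by (simp add: parseval_frame_def)
qed

end
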